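(* Let $n\geq 0$, let $a=(a_0,\dots,a_n)$ be a sequence of non-negative integers, and let $v=(v_0,\dots,v_n)$ be a sequence of non-negative integers whose largest part occurs with multiplicity one in $v$. Let $k$ be the (unique) index with $v_k=\max\{v_0,\dots,v_n\}$. Then \[ D_{v,v^{+}}(a)=q^{\sum_{i=k+1}^n a_i}\begin{bmatrix} v_k+|a|-1\\ a_k-1\end{bmatrix}_q D_{v^{(k)},(v^{(k)})^{+}}\big(a^{(k)}\big). \]
   Context: For an integer $k\geq 0$, $(z)_k=(z;q)_k=(1-z)(1-zq)\cdots(1-zq^{k-1})$. For an integer $N$ and a non-negative integer $j$, the $q$-binomial coefficient is $\begin{bmatrix} N\\ j\end{bmatrix}_q=(q^{N-j+1};q)_j/(q;q)_j$; for $j<0$ it is taken to be $0$. For a sequence $u=(u_0,\dots,u_n)$, $|u|=u_0+\cdots+u_n$, $u^{+}$ is the sequence of the $u_i$ rearranged in weakly decreasing order, and $u^{(k)}=(u_0,\dots,u_{k-1},u_{k+1},\dots,u_n)$. $h_r$ is the $r$th complete homogeneous symmetric function and for a partition $\lambda=(\lambda_0,\lambda_1,\dots)$, $h_\lambda=\prod_i h_{\lambda_i}$. For $a=(a_0,\dots,a_n)$ non-negative integers, $x^{(a)}$ is the list of $|a|$ variables $x_iq^j$, $0\leq i\leq n$, $0\leq j\leq a_i-1$. For $v\in\mathbb{Z}^{n+1}$ and a partition $\lambda$ with $|\lambda|=|v|$, \[ D_{v,\lambda}(a)=\mathrm{CT}_x\, x^{-v}h_\lambda\big(x^{(a)}\big)\prod_{0\leq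 i<j\leq n}(x_i/x_j;q)_{a_i}(qx_j/x_i;q)_{a_j}, \] where $x^{-v}=x_0^{-v_0}\cdots x_n^{-v_n}$ and $\mathrm{CT}_x$ denotes the constant term in $x_0,\dots,x_n$ of this Laurent polynomial (with coefficients in $\mathbb{Q}(q)$). For $n=0$ the quantity $D$ with empty index set is interpreted with the empty product equal to $1$.
   Formalization: The case n=0, v=(0), a=(0) is excluded: there the left side is 1, while the right side is 0 because the q-binomial coefficient with lower entry -1 is taken to be 0. *)

theory Defs
  imports
    "HOL-Library.Poly_Mapping"
    "HOL-Computational_Algebra.Polynomial"
    "HOL-Computational_Algebra.Fraction_Field"
begin

definition q_pochhammer :: "'a::comm_ring_1 \<Rightarrow> 'a \<Rightarrow> nat \<Rightarrow> 'a" where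
  "q_pochhammer z q k = (\<Prod>i<k. 1 - z * q ^ i)"

text \<open>The upper argument is an integer and may be negative; the value is \<open>0\<close> for every negative \<open>j\<close>,
  in particular for \<open>N = j = -1\<close>.\<close>

definition q_binomial :: "'a::field \<Rightarrow> int \<Rightarrow> int \<Rightarrow> 'a" where
  "q_binomial q N j =
     (if j < 0 then 0
      else q_pochhammer (q powi (N - j + 1)) q (nat j) / q_pochhammer q q (nat j))"

type_synonym ratfun = "rat poly fract"

definition qq :: ratfun where
  "qq = Fract [:0, 1:] 1"

text \<open>Laurent polynomials over \<open>\<rat>(q)\<close>, as the group algebra of the finitely supported integer
  exponent vectors. There are variables \<open>x\<^sub>i\<close> for all natural numbers \<open>i\<close>; any given Laurent
  polynomial involves only finitely many of them, and its constant term with respect to these is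
  the coefficient of the exponent vector \<open>0\<close>.\<close>

type_synonym laurent = "(nat \<Rightarrow>\<^sub>0 int) \<Rightarrow>\<^sub>0 ratfun"

definition scalar :: "ratfun \<Rightarrow> laurent" where
  "scalar c = Poly_Mapping.single 0 c"

definition xpow :: "nat \<Rightarrow> int \<Rightarrow> laurent" where
  "xpow i m = Poly_Mapping.single (Poly_Mapping.single i m) 1"

definition constant_term :: "laurent \<Rightarrow> ratfun" where
  "constant_term f = Poly_Mapping.lookup f 0"

text \<open>\<open>h\<^sub>r\<close> evaluated at a list of ring elements: the sum of \<open>y\<^bsub>i\<^sub>1\<^esub> \<cdots> y\<^bsub>i\<^sub>r\<^esub>\<close> over all weakly
  increasing index sequences \<open>i\<^sub>1 \<le> \<cdots> \<le> i\<^sub>r\<close>.\<close>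

definition complete_homogeneous :: "nat \<Rightarrow> 'a::comm_ring_1 list \<Rightarrow> 'a" where
  "complete_homogeneous r ys =
     (\<Sum>is | length is = r \<and> sorted is \<and> set is \<subseteq> {..<length ys}. \<Prod>i\<leftarrow>is. ys ! i)"

definition complete_homogeneous_part :: "nat list \<Rightarrow> 'a::comm_ring_1 list \<Rightarrow> 'a" where
  "complete_homogeneous_part lam ys = (\<Prod>r\<leftarrow>lam. complete_homogeneous r ys)"

definition alphabet :: "nat list \<Rightarrow> laurent list" where
  "alphabet a =
     concat (map (\<lambda>i. map (\<lambda>j. xpow i 1 * scalar (qq ^ j)) [0..<a ! i]) [0..<length a])"

text \<open>\<open>D\<^bsub>v,\<lambda>\<^esub>(a)\<close>, meant for \<open>length v = length a\<close> and \<open>\<lambda>\<close> a partition of \<open>|v|\<close>.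
  The index set \<open>{0, \<dots>, n}\<close> is \<open>{..<length a}\<close>, and it may be empty.\<close>

definition D :: "int list \<Rightarrow> nat list \<Rightarrow> nat list \<Rightarrow> ratfun" where
  "D v lam a = constant_term (
     (\<Prod>i<length v. xpow i (- (v ! i))) *
     complete_homogeneous_part lam (alphabet a) *
     (\<Prod>j<length a. \<Prod>i<j.
        q_pochhammer (xpow i 1 * xpow j (- 1)) (scalar qq) (a ! i) *
        q_pochhammer (scalar qq * xpow j 1 * xpow i (- 1)) (scalar qq) (a ! j)))"

definition decreasing :: "nat list \<Rightarrow> nat list" where
  "decreasing u = rev (sort u)"

definition omit :: "nat \<Rightarrow> 'a list \<Rightarrow> 'a list" where
  "omit k u = take k u @ drop (Suc k) u"

end

theory Submission imports Defs "HOL-Computational_Algebra.Polynomial_FPS" begin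

text \<open>Let \<open>\<Delta>\<close> be the q-Dyson product. Expand
  \<open>\<Sum>\<^sub>r w\<^sup>r h\<^sub>r(x\<^sup>(\<^sup>a\<^sup>)) \<Delta> = \<Delta> / \<Prod>\<^sub>i (w x\<^sub>i; q)\<^bsub>a\<^sub>i\<^esub>\<close> in partial fractions with respect to \<open>w\<close>. The
  denominators cancel in the coefficient of \<open>1 / (1 - w x\<^sub>i q\<^sup>j)\<close>: it is a Laurent polynomial without
  negative powers of \<open>x\<^sub>i\<close>. Taking \<open>r = v\<^sub>k\<close> and multiplying by \<open>x\<^bsup>-v\<^esup>\<close>, the \<open>i\<close>-th terms acquire the factor
  \<open>x\<^sub>i\<close> to the power \<open>v\<^sub>k - v\<^sub>i\<close>, which is positive for \<open>i \<noteq> k\<close>, so their constant terms vanish. In the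
  terms with \<open>i = k\<close> one may set \<open>x\<^sub>k = 0\<close>, which leaves the constant term for \<open>v\<^sup>(\<^sup>k\<^sup>)\<close> and \<open>a\<^sup>(\<^sup>k\<^sup>)\<close> times a
  scalar depending on \<open>j\<close>. The sum over \<open>j\<close> of these scalars is again a partial fraction expansion, of
  \<open>h\<^sub>r(1, q, \<dots>, q\<^bsup>a\<^sub>k - 1\<^esup>)\<close> with \<open>r = v\<^sub>k + |a| - a\<^sub>k\<close>, which is the q-binomial coefficient.\<close>

subsection \<open>Complete homogeneous symmetric functions\<close>

lemma right_inverse_unique:
  fixes a b c :: "'a::comm_monoid_mult"
  assumes "a * b = 1" "a * c = 1"
  shows "b = c"
proof -
  have "b = (a * c) * b" using assms(2) by simp
  also have "\<dots> = (a * b) * c" by (simp only: ac_simps)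
  finally show ?thesis using assms(1) by simp
qed

lemma complete_homogeneous_0 [simp]: "complete_homogeneous 0 ys = 1"
proof -
  have "{is :: nat list. length is = 0 \<and> sorted is \<and> set is \<subseteq> {..<length ys}} = {[]}" by auto
  then show ?thesis unfolding complete_homogeneous_def by simp
qed

lemma complete_homogeneous_Nil: "complete_homogeneous (Suc r) [] = 0"
proof -
  have "{is :: nat list. length is = Suc r \<and> sorted is \<and> set is \<subseteq> {..<length ([] :: 'a list)}} = {}"
    by auto
  then show ?thesis unfolding complete_homogeneous_def by (simp only: sum.empty)
qed

text \<open>Split the weakly increasing index sequences by whether index 0 occurs. If it does, it
  comes first and contributes the factor \<open>y\<close>; if not, lowering every index by one gives
  a sequence for \<open>ys\<close>.\<close>

lemma complete_homogeneous_Cons: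
  "complete_homogeneous (Suc r) (y # ys) =
     complete_homogeneous (Suc r) ys + y * complete_homogeneous r (y # ys)"
proof -
  define S where "S r n = {is. length is = r \<and> sorted is \<and> set is \<subseteq> {..<n}}" for r n :: nat
  have fin: "finite (S r n)" for r n
    by (rule finite_subset[OF _ finite_lists_length_eq[of "{..<n}" r]]) (auto simp: S_def)
  let ?n = "length ys"
  have split: "S (Suc r) (Suc ?n) = (map Suc) ` S (Suc r) ?n \<union> (Cons 0) ` S r (Suc ?n)"
  proof (intro equalityI subsetI)
    fix js assume js: "js \<in> S (Suc r) (Suc ?n)"
    then obtain i ks where eq: "js = i # ks" by (cases js) (auto simp: S_def)
    show "js \<in> (map Suc) ` S (Suc r) ?n \<union> (Cons 0) ` S r (Suc ?n)"
    proof (cases i)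
      case 0
      then have "ks \<in> S r (Suc ?n)" using js eq by (auto simp: S_def)
      then show ?thesis using eq 0 by auto
    next
      case (Suc i')
      then have pos: "\<forall>m\<in>set js. 0 < m" using js eq by (auto simp: S_def)
      have "js = map Suc (map (\<lambda>m. m - 1) js)"
        using pos by (auto simp: map_idI)
      moreover have "map (\<lambda>m. m - 1) js \<in> S (Suc r) ?n"
      proof -
        have "sorted (map (\<lambda>m. m - 1) js)"
          using js by (auto simp: S_def sorted_iff_nth_mono intro: diff_le_mono)
        moreover have "set (map (\<lambda>m. m - 1) js) \<subseteq> {..<?n}"
          using js pos by (auto simp: S_def) (metis lessThan_iff less_Suc_eq_0_disj subsetD
            Suc_pred not_less_eq)
        ultimately show ?thesis using js by (simp add: S_def)
      qed
      ultimately show ?thesis by blast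
    qed
  next
    fix js assume "js \<in> (map Suc) ` S (Suc r) ?n \<union> (Cons 0) ` S r (Suc ?n)"
    then show "js \<in> S (Suc r) (Suc ?n)"
      by (auto simp: S_def sorted_map)
  qed
  have disj: "(map Suc) ` S (Suc r) ?n \<inter> (Cons 0) ` S r (Suc ?n) = {}"
    by (auto simp: S_def)
  have "complete_homogeneous (Suc r) (y # ys) = (\<Sum>js\<in>S (Suc r) (Suc ?n). \<Prod>i\<leftarrow>js. (y # ys) ! i)"
    by (simp add: complete_homogeneous_def S_def)
  also have "\<dots> = (\<Sum>js\<in>(map Suc) ` S (Suc r) ?n. \<Prod>i\<leftarrow>js. (y # ys) ! i)
      + (\<Sum>js\<in>(Cons 0) ` S r (Suc ?n). \<Prod>i\<leftarrow>js. (y # ys) ! i)"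
    unfolding split by (rule sum.union_disjoint) (use fin disj in auto)
  also have "(\<Sum>js\<in>(map Suc) ` S (Suc r) ?n. \<Prod>i\<leftarrow>js. (y # ys) ! i)
      = (\<Sum>js\<in>S (Suc r) ?n. \<Prod>i\<leftarrow>js. ys ! i)"
    by (subst sum.reindex) (auto simp: o_def inj_on_def)
  also have "(\<Sum>js\<in>(Cons 0) ` S r (Suc ?n). \<Prod>i\<leftarrow>js. (y # ys) ! i)
      = y * (\<Sum>js\<in>S r (Suc ?n). \<Prod>i\<leftarrow>js. (y # ys) ! i)"
    by (subst sum.reindex) (auto simp: o_def inj_on_def sum_distrib_left)
  finally show ?thesis by (simp add: complete_homogeneous_def S_def)
qed

text \<open>Setting a variable to zero turns some letters of the alphabet into 0; this allows
  deleting them. By the recursion, a leading 0 does not change the value.\<close>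

lemma complete_homogeneous_filter_nonzero:
  "complete_homogeneous r (filter (\<lambda>y. y \<noteq> 0) ys) = complete_homogeneous r ys"
proof (induction ys arbitrary: r)
  case (Cons y ys)
  show ?case
  proof (induction r)
    case (Suc r)
    then show ?case
      using Cons.IH[of "Suc r"] by (cases "y = 0") (simp_all add: complete_homogeneous_Cons)
  qed simp
qed simp

text \<open>Multiplying the generating function by \<open>1 - y X\<close> undoes the recursion for
  the first letter, so the letters can be removed one at a time. The product form avoids division,
  since the letters lie in a ring of Laurent polynomials.\<close>

lemma complete_homogeneous_fps:
  "(\<Prod>y\<leftarrow>ys. 1 - fps_const y * fps_X) * Abs_fps (\<lambda>r. complete_homogeneous r ys) = 1"
proof (induction ys)
  case Nil
  have "complete_homogeneous r [] = (if r = 0 then 1 else 0 :: 'a)" for r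
    by (cases r) (simp_all add: complete_homogeneous_Nil)
  then show ?case by (auto simp: fps_eq_iff)
next
  case (Cons y ys)
  have "(1 - fps_const y * fps_X) * Abs_fps (\<lambda>r. complete_homogeneous r (y # ys))
      = Abs_fps (\<lambda>r. complete_homogeneous r ys)"
  proof (rule fps_ext)
    fix r
    show "fps_nth ((1 - fps_const y * fps_X) * Abs_fps (\<lambda>r. complete_homogeneous r (y # ys))) r
      = fps_nth (Abs_fps (\<lambda>r. complete_homogeneous r ys)) r"
      by (cases r) (simp_all add: ring_distribs mult.assoc complete_homogeneous_Cons)
  qed
  then have "(\<Prod>y\<leftarrow>ys. 1 - fps_const y * fps_X) * ((1 - fps_const y * fps_X)
      * Abs_fps (\<lambda>r. complete_homogeneous r (y # ys))) = 1"
    using Cons.IH by simp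
  then show ?case by (simp only: list.map prod_list.Cons ac_simps)
qed

lemma complete_homogeneous_snoc:
  fixes y :: "'a::comm_ring_1"
  shows "complete_homogeneous (Suc r) (ys @ [y]) =
     complete_homogeneous (Suc r) ys + y * complete_homogeneous r (ys @ [y])"
proof -
  define H where "H ys = Abs_fps (\<lambda>r. complete_homogeneous r ys)" for ys :: "'a list"
  define E where "E ys = (\<Prod>y\<leftarrow>ys. 1 - fps_const y * fps_X)" for ys :: "'a list"
  have EH: "E ys * H ys = 1" for ys
    unfolding E_def H_def by (rule complete_homogeneous_fps)
  \<comment> \<open>The generating function does not see the order of the letters: inserting
    \<open>E ys * H ys = 1\<close> completes the left factor to \<open>E (ys @ [y])\<close>, so
    \<open>y\<close> can be removed from the end as well.\<close>
  have "(1 - fps_const y * fps_X) * H (ys @ [y]) = (1 - fps_const y * fps_X) * H (ys @ [y]) * (E ys * H ys)"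
    by (simp add: EH)
  also have "\<dots> = (E (ys @ [y]) * H (ys @ [y])) * H ys"
    by (simp add: E_def ac_simps)
  finally have "H (ys @ [y]) = H ys + fps_const y * fps_X * H (ys @ [y])"
    by (simp add: EH algebra_simps)
  then have "fps_nth (H (ys @ [y])) (Suc r) = fps_nth (H ys + fps_const y * fps_X * H (ys @ [y])) (Suc r)"
    by simp
  then show ?thesis by (simp add: H_def mult.assoc)
qed

text \<open>In the expansion of c / prod (1 - y_p X) into terms B_p / (1 - y_p X), the coefficient
  B_p is found by clearing denominators and setting X to 1 / y_p. The inverse is supplied as
  \<open>z p\<close> and the division as the equation for \<open>B p\<close>, so an integral domain
  suffices. For an empty list and \<open>r = 0\<close> the left side is \<open>c\<close> and the
  right side 0, which \<open>nontriv\<close> excludes.\<close>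

lemma complete_homogeneous_partial_fractions:
  fixes y z B :: "'b \<Rightarrow> 'a::idom"
  assumes dist: "distinct ps" and inj: "inj_on y (set ps)"
    and yz: "\<And>p. p \<in> set ps \<Longrightarrow> y p * z p = 1"
    and B: "\<And>p. p \<in> set ps \<Longrightarrow> B p * (\<Prod>p'\<in>set ps - {p}. 1 - y p' * z p) = c"
    and nontriv: "ps \<noteq> [] \<or> r > 0"
  shows "c * complete_homogeneous r (map y ps) = (\<Sum>p\<in>set ps. B p * y p ^ r)"
proof (cases "ps = []")
  case True
  then show ?thesis using nontriv by (cases r) (auto simp: complete_homogeneous_Nil)
next
  case False
  let ?A = "set ps"
  \<comment> \<open>\<open>P\<close> is the numerator of the sum after clearing denominators. It
    agrees with the constant \<open>c\<close> at as many points as there are letters, one more than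
    its degree allows unless it equals \<open>c\<close>.\<close>
  define P where "P = (\<Sum>p\<in>?A. [:B p:] * (\<Prod>p'\<in>?A - {p}. [:1, - y p':]))"
  have "P - [:c:] = 0"
  proof (rule ccontr)
    assume nz: "P - [:c:] \<noteq> 0"
    have cards: "card (?A - {p}) < card ?A" if "p \<in> ?A" for p
      using that by (intro psubset_card_mono) auto
    have degP: "degree P \<le> card ?A - 1" unfolding P_def
    proof (rule degree_sum_le)
      fix p assume p: "p \<in> ?A"
      have "degree (\<Prod>p'\<in>?A - {p}. [:1, - y p':]) \<le> (\<Sum>p'\<in>?A - {p}. degree [:1, - y p':])"
        by (rule degree_prod_sum_le[unfolded o_def]) simp
      also have "\<dots> \<le> (\<Sum>p'\<in>?A - {p}. 1)" by (rule sum_mono) simp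
      finally have "degree (\<Prod>p'\<in>?A - {p}. [:1, - y p':]) \<le> card ?A - 1" using cards[OF p] by simp
      then show "degree ([:B p:] * (\<Prod>p'\<in>?A - {p}. [:1, - y p':])) \<le> card ?A - 1"
        using degree_mult_le[of "[:B p:]"] by (intro order_trans[OF degree_mult_le]) simp
    qed simp
    have deg: "degree (P - [:c:]) < card ?A"
    proof -
      have "card ?A > 0" using False by (simp add: card_gt_0_iff)
      then show ?thesis using degP by (intro le_less_trans[OF degree_diff_le_max]) simp
    qed
    \<comment> \<open>At \<open>z p\<close> every summand except the one for \<open>p\<close>
      contains the vanishing factor \<open>1 - y p * z p\<close>.\<close>
    have root: "poly P (z p) = c" if p: "p \<in> ?A" for p
    proof -
      have z: "poly ([:B p':] * (\<Prod>p''\<in>?A - {p'}. [:1, - y p'':])) (z p) = 0"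
        if "p' \<in> ?A - {p}" for p'
        using that p yz[OF p] by (auto simp: poly_prod mult.commute intro!: bexI[of _ p])
      have "poly P (z p) = (\<Sum>p'\<in>?A. poly ([:B p':] * (\<Prod>p''\<in>?A - {p'}. [:1, - y p'':])) (z p))"
        by (simp add: P_def poly_sum)
      also have "\<dots> = poly ([:B p:] * (\<Prod>p''\<in>?A - {p}. [:1, - y p'':])) (z p)"
        using sum.neutral[of "?A - {p}", OF ballI, OF z] by (simp only: sum.remove[OF finite_set p] add_0_right)
      also have "\<dots> = c" using B[OF p] by (simp add: poly_prod mult.commute)
      finally show ?thesis .
    qed
    have injz: "inj_on z ?A"
    proof (rule inj_onI)
      fix p p' assume p: "p \<in> ?A" "p' \<in> ?A" and eq: "z p = z p'"
      have "z p * y p = 1" "z p * y p' = 1" using yz[OF p(1)] yz[OF p(2)] eq by (simp_all add: mult.commute)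
      then have "y p = y p'" by (rule right_inverse_unique)
      then show "p = p'" using inj p by (auto dest: inj_onD)
    qed
    have "card ?A = card (z ` ?A)" using injz by (simp add: card_image)
    also have "\<dots> \<le> card {x. poly (P - [:c:]) x = 0}"
      using root by (intro card_mono poly_roots_finite[OF nz]) auto
    also have "\<dots> \<le> degree (P - [:c:])" by (rule card_poly_roots_bound[OF nz])
    finally show False using deg by simp
  qed
  then have Pc: "P = [:c:]" by simp
  define H where "H = Abs_fps (\<lambda>r. complete_homogeneous r (map y ps))"
  define E where "E p = 1 - fps_const (y p) * fps_X" for p
  have EH: "(\<Prod>p\<in>?A. E p) * H = 1"
    using complete_homogeneous_fps[of "map y ps"] dist
    by (simp add: H_def E_def o_def prod.distinct_set_conv_list)
  \<comment> \<open>Both sides are inverse to \<open>E p\<close>; this turns each partial fraction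
    into a geometric series, whose coefficients are the powers of \<open>y p\<close>.\<close>
  have geo: "(\<Prod>p'\<in>?A - {p}. E p') * H = Abs_fps (\<lambda>r. y p ^ r)" if "p \<in> ?A" for p
  proof -
    have 1: "E p * Abs_fps (\<lambda>r. y p ^ r) = 1"
    proof (rule fps_ext)
      fix m show "fps_nth (E p * Abs_fps (\<lambda>r. y p ^ r)) m = fps_nth 1 m"
        by (cases m) (simp_all add: E_def ring_distribs mult.assoc)
    qed
    have "(\<Prod>p\<in>?A. E p) = E p * (\<Prod>p'\<in>?A - {p}. E p')"
      using that by (simp add: prod.remove)
    then have 2: "E p * ((\<Prod>p'\<in>?A - {p}. E p') * H) = 1" using EH by (simp add: mult.assoc)
    show ?thesis by (rule right_inverse_unique[OF 2 1])
  qed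
  have Epoly: "fps_of_poly [:1, - y p:] = E p" for p
    by (rule fps_ext) (simp add: E_def coeff_pCons fps_X_def split: nat.split)
  have "fps_of_poly P = (\<Sum>p\<in>?A. fps_const (B p) * (\<Prod>p'\<in>?A - {p}. E p'))"
    unfolding P_def by (simp only: fps_of_poly_sum fps_of_poly_mult fps_of_poly_prod Epoly fps_of_poly_const)
  then have "fps_const c * H = (\<Sum>p\<in>?A. fps_const (B p) * ((\<Prod>p'\<in>?A - {p}. E p') * H))"
    by (simp add: Pc fps_of_poly_const sum_distrib_right mult.assoc)
  also have "\<dots> = (\<Sum>p\<in>?A. fps_const (B p) * Abs_fps (\<lambda>r. y p ^ r))"
    by (intro sum.cong) (simp_all add: geo)
  finally have "fps_nth (fps_const c * H) r = fps_nth (\<Sum>p\<in>?A. fps_const (B p) * Abs_fps (\<lambda>r. y p ^ r)) r"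
    by simp
  then show ?thesis by (simp add: H_def fps_sum_nth)
qed

text \<open>The principal specialization: h_r(1, q, ..., q^m) is a q-binomial coefficient, stated
  without denominators. The recursion for the last letter becomes the q-Pascal rule, whence the
  double induction on \<open>m\<close> and \<open>r\<close>.\<close>

lemma complete_homogeneous_powers:
  "q_pochhammer q q m * complete_homogeneous r (map ((^) q) [0..<Suc m]) =
     q_pochhammer (q ^ Suc r) q m"
proof (induction m arbitrary: r)
  case 0
  have "complete_homogeneous r [1 :: 'a] = 1"
    by (induction r) (simp_all add: complete_homogeneous_Cons complete_homogeneous_Nil)
  then show ?case by (simp add: q_pochhammer_def)
next
  case (Suc m)
  show ?case
  proof (induction r)
    case 0
    show ?case by simp
  next
    case (Suc r)
    let ?h = "\<lambda>r m. complete_homogeneous r (map ((^) q) [0..<m])"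
    have "?h (Suc r) (Suc (Suc m)) = ?h (Suc r) (Suc m) + q ^ Suc m * ?h r (Suc (Suc m))"
      using complete_homogeneous_snoc[of r "map ((^) q) [0..<Suc m]" "q ^ Suc m"] by simp
    then have "q_pochhammer q q (Suc m) * ?h (Suc r) (Suc (Suc m))
      = (1 - q ^ Suc m) * (q_pochhammer q q m * ?h (Suc r) (Suc m))
        + q ^ Suc m * (q_pochhammer q q (Suc m) * ?h r (Suc (Suc m)))"
      by (simp add: q_pochhammer_def algebra_simps)
    also have "\<dots> = (1 - q ^ Suc m) * q_pochhammer (q ^ Suc (Suc r)) q m
        + q ^ Suc m * q_pochhammer (q ^ Suc r) q (Suc m)"
      by (simp only: Suc.IH \<open>\<And>r. _ = q_pochhammer (q ^ Suc r) q m\<close>)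
    also have "q_pochhammer (q ^ Suc r) q (Suc m)
        = (1 - q ^ Suc r) * q_pochhammer (q ^ Suc (Suc r)) q m"
      unfolding q_pochhammer_def by (subst prod.lessThan_Suc_shift) (simp add: ac_simps)
    also have "(1 - q ^ Suc m) * q_pochhammer (q ^ Suc (Suc r)) q m
        + q ^ Suc m * ((1 - q ^ Suc r) * q_pochhammer (q ^ Suc (Suc r)) q m)
      = q_pochhammer (q ^ Suc (Suc r)) q (Suc m)"
      by (simp add: q_pochhammer_def algebra_simps power_add)
    finally show ?case .
  qed
qed

subsection \<open>Setting a variable to zero\<close>

text \<open>The increasing enumeration of the indices other than \<open>k\<close>; it translates
  positions in \<open>omit k u\<close> into positions in \<open>u\<close>.\<close>

definition skip :: "nat \<Rightarrow> nat \<Rightarrow> nat" where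
  "skip k i = (if i < k then i else Suc i)"

lemma inj_skip: "inj (skip k)"
  by (auto simp: inj_def skip_def split: if_splits)

lemma skip_neq [simp]: "skip k i \<noteq> k" "k \<noteq> skip k i"
  by (auto simp: skip_def)

lemma skip_less_iff [simp]: "skip k i < skip k j \<longleftrightarrow> i < j"
  by (auto simp: skip_def)

lemma skip_eq_iff [simp]: "skip k i = skip k j \<longleftrightarrow> i = j"
  by (auto simp: skip_def)

lemma skip_le: "i < n \<Longrightarrow> skip k i \<le> n"
  by (auto simp: skip_def)

lemma image_skip: "k \<le> n \<Longrightarrow> skip k ` {..<n} = {..<Suc n} - {k}"
proof (intro equalityI subsetI)
  fix j assume "k \<le> n" "j \<in> {..<Suc n} - {k}"
  then have "j = skip k (if j < k then j else j - 1)" "(if j < k then j else j - 1) < n"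
    by (auto simp: skip_def)
  then show "j \<in> skip k ` {..<n}" by blast
qed (auto simp: skip_le less_Suc_eq_le)

text \<open>Proved in the locale so that it serves for both sums and products.\<close>

lemma (in comm_monoid_set) lessThan_Suc_skip:
  assumes "k \<le> n"
  shows "F g {..<Suc n} = g k \<^bold>* F (\<lambda>i. g (skip k i)) {..<n}"
proof -
  have "F g {..<Suc n} = g k \<^bold>* F g ({..<Suc n} - {k})"
    using assms by (intro remove) auto
  also have "F g ({..<Suc n} - {k}) = F (\<lambda>i. g (skip k i)) {..<n}"
    unfolding image_skip[OF assms, symmetric]
    by (subst reindex) (auto simp: o_def inj_on_def)
  finally show ?thesis .
qed

text \<open>The pairs containing \<open>k\<close> are separated from the rest. Symmetry of
  \<open>f\<close> is what allows \<open>k\<close> to be written first even when it is the larger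
  index.\<close>

lemma prod_pairs_skip:
  fixes f :: "nat \<Rightarrow> nat \<Rightarrow> 'a::comm_monoid_mult"
  assumes "k \<le> n" and sym: "\<And>i j. f i j = f j i"
  shows "(\<Prod>j<Suc n. \<Prod>i<j. f i j) =
    (\<Prod>l<n. f k (skip k l)) * (\<Prod>j<n. \<Prod>i<j. f (skip k i) (skip k j))"
  using assms(1)
proof (induction n)
  case 0
  then show ?case by simp
next
  case (Suc n)
  show ?case
  proof (cases "k = Suc n")
    case True
    have "(\<Prod>l<Suc n. f k (skip k l)) = (\<Prod>l<Suc n. f l k)"
      using True by (intro prod.cong) (auto simp: skip_def sym)
    moreover have "(\<Prod>j<Suc n. \<Prod>i<j. f (skip k i) (skip k j)) = (\<Prod>j<Suc n. \<Prod>i<j. f i j)"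
      using True by (intro prod.cong) (auto simp: skip_def)
    ultimately show ?thesis using True by (simp add: mult.commute)
  next
    case False
    then have k: "k \<le> n" using Suc.prems by simp
    have s: "skip k n = Suc n" using k by (simp add: skip_def)
    have "(\<Prod>j<Suc (Suc n). \<Prod>i<j. f i j) = (\<Prod>j<Suc n. \<Prod>i<j. f i j) * (\<Prod>i<Suc n. f i (Suc n))"
      by simp
    also have "(\<Prod>i<Suc n. f i (Suc n)) = f k (Suc n) * (\<Prod>i<n. f (skip k i) (Suc n))"
      by (rule prod.lessThan_Suc_skip[OF k])
    finally show ?thesis using Suc.IH[OF k] by (simp add: s ac_simps del: prod.lessThan_Suc)
      (simp add: s ac_simps)
  qed
qed

section \<open>Order of vanishing in one variable\<close>

text \<open>A lower bound for the valuation at \<open>x_k = 0\<close>, satisfied by the zero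
  polynomial for every \<open>m\<close>. The case \<open>m = 0\<close> is regularity, under which
  \<open>x_k = 0\<close> may be substituted; the case \<open>m = 1\<close> forces the constant term
  to vanish.\<close>

definition ord_ge :: "nat \<Rightarrow> int \<Rightarrow> laurent \<Rightarrow> bool" where
  "ord_ge k m f \<longleftrightarrow> (\<forall>e. Poly_Mapping.lookup f e \<noteq> 0 \<longrightarrow> m \<le> Poly_Mapping.lookup e k)"

lemma laurent_sum_monomials:
  fixes f :: laurent
  assumes "finite A" "Poly_Mapping.keys f \<subseteq> A"
  shows "f = (\<Sum>e\<in>A. Poly_Mapping.single e (Poly_Mapping.lookup f e))"
proof (rule poly_mapping_eqI)
  fix e
  have "(\<Sum>e'\<in>A. Poly_Mapping.lookup (Poly_Mapping.single e' (Poly_Mapping.lookup f e')) e)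
     = (\<Sum>e'\<in>A. if e' = e then Poly_Mapping.lookup f e else 0)"
    by (intro sum.cong) (auto simp: lookup_single when_def)
  also have "\<dots> = Poly_Mapping.lookup f e"
    using assms by (auto simp: in_keys_iff)
  finally show "Poly_Mapping.lookup f e =
      Poly_Mapping.lookup (\<Sum>e\<in>A. Poly_Mapping.single e (Poly_Mapping.lookup f e)) e"
    by (simp add: lookup_sum)
qed

lemma laurent_mult_monomials:
  fixes f g :: laurent
  shows "f * g = (\<Sum>e\<in>Poly_Mapping.keys f. \<Sum>e'\<in>Poly_Mapping.keys g.
    Poly_Mapping.single (e + e') (Poly_Mapping.lookup f e * Poly_Mapping.lookup g e'))"
proof -
  have "f * g = (\<Sum>e\<in>Poly_Mapping.keys f. Poly_Mapping.single e (Poly_Mapping.lookup f e))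
    * (\<Sum>e\<in>Poly_Mapping.keys g. Poly_Mapping.single e (Poly_Mapping.lookup g e))"
    using laurent_sum_monomials[of "Poly_Mapping.keys f" f]
      laurent_sum_monomials[of "Poly_Mapping.keys g" g] by simp
  then show ?thesis by (simp add: sum_product mult_single)
qed

lemma ord_ge_0 [simp]: "ord_ge k m 0"
  by (simp add: ord_ge_def)

lemma ord_ge_add: "ord_ge k m f \<Longrightarrow> ord_ge k m g \<Longrightarrow> ord_ge k m (f + g)"
  by (auto simp: ord_ge_def lookup_add) (metis add.right_neutral)

lemma ord_ge_diff: "ord_ge k m f \<Longrightarrow> ord_ge k m g \<Longrightarrow> ord_ge k m (f - g)"
  by (auto simp: ord_ge_def lookup_minus) (metis diff_zero)

lemma ord_ge_sum: "(\<And>i. i \<in> A \<Longrightarrow> ord_ge k m (f i)) \<Longrightarrow> ord_ge k m (\<Sum>i\<in>A. f i)"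
  by (induction A rule: infinite_finite_induct) (auto intro: ord_ge_add)

lemma ord_ge_single: "m \<le> Poly_Mapping.lookup e k \<Longrightarrow> ord_ge k m (Poly_Mapping.single e c)"
  by (auto simp: ord_ge_def lookup_single when_def)

lemma ord_ge_mult:
  assumes "ord_ge k m f" "ord_ge k l g"
  shows "ord_ge k (m + l) (f * g)"
  unfolding laurent_mult_monomials
  using assms by (intro ord_ge_sum ord_ge_single) (auto simp: ord_ge_def lookup_add in_keys_iff intro: add_mono)

lemma ord_ge_mult_0: "ord_ge k 0 f \<Longrightarrow> ord_ge k 0 g \<Longrightarrow> ord_ge k 0 (f * g)"
  using ord_ge_mult[of k 0 f 0 g] by simp

lemma ord_ge_one [simp]: "ord_ge k 0 1"
  unfolding single_one[symmetric] by (rule ord_ge_single) simp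

lemma ord_ge_scalar [simp]: "ord_ge k 0 (scalar c)"
  unfolding scalar_def by (rule ord_ge_single) simp

lemma ord_ge_xpow: "(if i = k then m else 0) \<ge> l \<Longrightarrow> ord_ge k l (xpow i m)"
  unfolding xpow_def by (rule ord_ge_single) (auto simp: lookup_single when_def)

lemma ord_ge_prod: "(\<And>i. i \<in> A \<Longrightarrow> ord_ge k 0 (f i)) \<Longrightarrow> ord_ge k 0 (\<Prod>i\<in>A. f i)"
  by (induction A rule: infinite_finite_induct) (auto intro: ord_ge_mult_0)

lemma ord_ge_complete_homogeneous:
  "(\<And>y. y \<in> set ys \<Longrightarrow> ord_ge k 0 y) \<Longrightarrow> ord_ge k 0 (complete_homogeneous r ys)"
proof (induction ys arbitrary: r)
  case Nil
  then show ?case by (cases r) (auto simp: complete_homogeneous_Nil)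
next
  case (Cons y ys)
  have y: "ord_ge k 0 y" and ys: "ord_ge k 0 (complete_homogeneous r ys)" for r
    using Cons.prems by (auto intro: Cons.IH)
  show ?case
    by (induction r) (simp_all add: complete_homogeneous_Cons ord_ge_add ord_ge_mult_0 y ys)
qed

section \<open>Constant terms, scalars and monomials\<close>

lemma constant_term_ord_ge_1: "ord_ge k 1 f \<Longrightarrow> constant_term f = 0"
  by (auto simp: ord_ge_def constant_term_def dest: spec[of _ 0])

lemma constant_term_sum: "constant_term (\<Sum>i\<in>A. f i) = (\<Sum>i\<in>A. constant_term (f i))"
  by (simp add: constant_term_def lookup_sum)

lemma constant_term_scalar_mult: "constant_term (scalar c * f) = c * constant_term f"
proof -
  have "scalar c * f = (\<Sum>e\<in>Poly_Mapping.keys f. Poly_Mapping.single e (c * Poly_Mapping.lookup f e))"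
    unfolding scalar_def
    by (subst laurent_sum_monomials[of "Poly_Mapping.keys f" f, OF _ order_refl])
      (simp_all add: sum_distrib_left mult_single)
  then have "constant_term (scalar c * f)
     = (\<Sum>e\<in>Poly_Mapping.keys f. if e = 0 then c * Poly_Mapping.lookup f 0 else 0)"
    by (auto simp: constant_term_def lookup_sum lookup_single when_def intro!: sum.cong)
  then show ?thesis by (auto simp: constant_term_def in_keys_iff)
qed

lemma scalar_mult: "scalar (c * d) = scalar c * scalar d"
  by (simp add: scalar_def mult_single)

lemma scalar_1 [simp]: "scalar 1 = 1"
  by (simp add: scalar_def)

lemma scalar_diff: "scalar (c - d) = scalar c - scalar d"
  by (simp add: scalar_def single_diff)

lemma scalar_power: "scalar (c ^ r) = scalar c ^ r"
  by (induction r) (simp_all add: scalar_mult)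

lemma scalar_prod: "scalar (\<Prod>i\<in>A. f i) = (\<Prod>i\<in>A. scalar (f i))"
  by (induction A rule: infinite_finite_induct) (simp_all add: scalar_mult)

lemma xpow_add: "xpow i (m + l) = xpow i m * xpow i l"
  by (simp add: xpow_def mult_single single_add)

lemma xpow_0 [simp]: "xpow i 0 = 1"
  by (simp add: xpow_def)

lemma xpow_power: "xpow i 1 ^ r = xpow i (int r)"
  by (induction r) (simp_all add: xpow_add[symmetric] add.commute)

text \<open>On Laurent polynomials that are regular in \<open>x\<^sub>k\<close>, this is the substitution \<open>x\<^sub>k = 0\<close>, followed by
  the renaming that closes the gap in the numbering of the variables.\<close>

definition drop_var :: "nat \<Rightarrow> laurent \<Rightarrow> laurent" where
  "drop_var k f = (\<Sum>e\<in>Poly_Mapping.keys f.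
     if Poly_Mapping.lookup e k = 0
     then Poly_Mapping.single (Poly_Mapping.map_key (skip k) e) (Poly_Mapping.lookup f e) else 0)"

text \<open>Allows two polynomials to be summed over a common set of exponents, as additivity
  requires.\<close>

lemma drop_var_superset:
  assumes "finite A" "Poly_Mapping.keys f \<subseteq> A"
  shows "drop_var k f = (\<Sum>e\<in>A.
     if Poly_Mapping.lookup e k = 0
     then Poly_Mapping.single (Poly_Mapping.map_key (skip k) e) (Poly_Mapping.lookup f e) else 0)"
  unfolding drop_var_def using assms
  by (intro sum.mono_neutral_left) (auto simp: in_keys_iff)

lemma drop_var_single: "drop_var k (Poly_Mapping.single e c) =
  (if Poly_Mapping.lookup e k = 0
   then Poly_Mapping.single (Poly_Mapping.map_key (skip k) e) c else 0)"
  by (subst drop_var_superset[of "{e}"]) auto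

lemma drop_var_0 [simp]: "drop_var k 0 = 0"
  by (simp add: drop_var_def)

lemma drop_var_add: "drop_var k (f + g) = drop_var k f + drop_var k g"
proof -
  let ?A = "Poly_Mapping.keys f \<union> Poly_Mapping.keys g"
  have "Poly_Mapping.keys (f + g) \<subseteq> ?A" by (rule Poly_Mapping.keys_add)
  then show ?thesis
    by (simp add: drop_var_superset[of ?A] flip: sum.distrib)
      (auto simp: lookup_add single_add intro!: sum.cong)
qed

lemma drop_var_diff: "drop_var k (f - g) = drop_var k f - drop_var k g"
  using drop_var_add[of k "f - g" g] by simp

lemma drop_var_sum: "drop_var k (\<Sum>i\<in>A. f i) = (\<Sum>i\<in>A. drop_var k (f i))"
  by (induction A rule: infinite_finite_induct) (simp_all add: drop_var_add)

text \<open>Regularity is essential: two nonnegative exponents of \<open>x_k\<close> add up to 0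
  only if both are 0, so no cross terms such as x_k times 1 / x_k survive in the product.\<close>

lemma drop_var_mult:
  assumes f: "ord_ge k 0 f" and g: "ord_ge k 0 g"
  shows "drop_var k (f * g) = drop_var k f * drop_var k g"
proof -
  let ?l = Poly_Mapping.lookup and ?s = Poly_Mapping.single and ?K = Poly_Mapping.keys
  have mono: "drop_var k (?s (e + e') (?l f e * ?l g e')) = drop_var k (?s e (?l f e)) * drop_var k (?s e' (?l g e'))"
    if "e \<in> ?K f" "e' \<in> ?K g" for e e'
  proof -
    have "?l e k \<ge> 0" "?l e' k \<ge> 0" using that f g by (auto simp: ord_ge_def in_keys_iff)
    then show ?thesis
      by (auto simp: drop_var_single lookup_add map_key_plus[OF inj_skip] mult_single)
  qed
  have expand: "drop_var k h = (\<Sum>e\<in>?K h. drop_var k (?s e (?l h e)))" for h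
    using laurent_sum_monomials[of "?K h" h] drop_var_sum[of k "\<lambda>e. ?s e (?l h e)" "?K h"] by simp
  have "drop_var k (f * g) = (\<Sum>e\<in>?K f. \<Sum>e'\<in>?K g. drop_var k (?s e (?l f e)) * drop_var k (?s e' (?l g e')))"
    by (simp add: laurent_mult_monomials drop_var_sum mono)
  also have "\<dots> = drop_var k f * drop_var k g"
    by (simp only: sum_product[symmetric] expand[of f, symmetric] expand[of g, symmetric])
  finally show ?thesis .
qed

lemma drop_var_scalar [simp]: "drop_var k (scalar c) = scalar c"
  by (simp add: scalar_def drop_var_single inj_skip)

lemma drop_var_1 [simp]: "drop_var k 1 = 1"
  using drop_var_scalar[of k 1] by simp

lemma drop_var_xpow_skip [simp]: "drop_var k (xpow (skip k i) m) = xpow i m"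
  by (simp add: xpow_def drop_var_single lookup_single when_def inj_skip)

lemma drop_var_xpow_eq_0 [simp]: "m \<noteq> 0 \<Longrightarrow> drop_var k (xpow k m) = 0"
  by (simp add: xpow_def drop_var_single)

lemma drop_var_prod:
  "(\<And>i. i \<in> A \<Longrightarrow> ord_ge k 0 (f i)) \<Longrightarrow> drop_var k (\<Prod>i\<in>A. f i) = (\<Prod>i\<in>A. drop_var k (f i))"
  by (induction A rule: infinite_finite_induct) (auto simp: drop_var_mult ord_ge_prod)

lemma drop_var_complete_homogeneous:
  "(\<And>y. y \<in> set ys \<Longrightarrow> ord_ge k 0 y) \<Longrightarrow>
    drop_var k (complete_homogeneous r ys) = complete_homogeneous r (map (drop_var k) ys)"
proof (induction ys arbitrary: r)
  case Nil
  then show ?case by (cases r) (auto simp: complete_homogeneous_Nil)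
next
  case (Cons y ys)
  show ?case
  proof (induction r)
    case (Suc r)
    have "ord_ge k 0 (complete_homogeneous r (y # ys))"
      by (rule ord_ge_complete_homogeneous) (rule Cons.prems)
    moreover have "ord_ge k 0 y" using Cons.prems by simp
    moreover have "drop_var k (complete_homogeneous (Suc r) ys)
        = complete_homogeneous (Suc r) (map (drop_var k) ys)"
      using Cons.prems by (intro Cons.IH) simp
    ultimately show ?case using Suc by (simp add: complete_homogeneous_Cons drop_var_add drop_var_mult)
  qed simp
qed

text \<open>An exponent vector with entry 0 at \<open>k\<close> is determined by its renumbered
  image, so only the vector 0 is sent to 0. No regularity is involved.\<close>

lemma constant_term_drop_var: "constant_term (drop_var k f) = constant_term f"
proof -
  have "e = 0" if "Poly_Mapping.lookup e k = 0" "Poly_Mapping.map_key (skip k) e = 0" for e :: "nat \<Rightarrow>\<^sub>0 int"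
  proof (rule poly_mapping_eqI)
    fix j
    show "Poly_Mapping.lookup e j = Poly_Mapping.lookup 0 j"
    proof (cases "j = k")
      case False
      then have j: "j = skip k (if j < k then j else j - 1)" by (auto simp: skip_def)
      have "Poly_Mapping.lookup (Poly_Mapping.map_key (skip k) e) i = 0" for i
        using that(2) by simp
      then have "Poly_Mapping.lookup e (skip k i) = 0" for i
        by (simp add: map_key.rep_eq[OF inj_skip])
      then show ?thesis by (subst j) simp
    qed (simp add: that)
  qed
  then have *: "Poly_Mapping.lookup e k = 0 \<and> Poly_Mapping.map_key (skip k) e = 0 \<longleftrightarrow> e = 0" for e :: "nat \<Rightarrow>\<^sub>0 int"
    by (auto simp: map_key_zero[OF inj_skip])
  have "constant_term (drop_var k f) = (\<Sum>e\<in>Poly_Mapping.keys f.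
      if Poly_Mapping.lookup e k = 0 \<and> Poly_Mapping.map_key (skip k) e = 0 then Poly_Mapping.lookup f e else 0)"
    unfolding constant_term_def drop_var_def lookup_sum
    by (intro sum.cong refl) (auto simp: lookup_single when_def)
  also have "\<dots> = constant_term f"
    by (auto simp: * constant_term_def in_keys_iff)
  finally show ?thesis .
qed

subsection \<open>The q-Dyson product\<close>

lemma qq_power: "qq ^ m = Fract (monom 1 m) 1"
  by (induction m) (simp_all add: qq_def One_fract_def monom_0 monom_Suc one_pCons[symmetric])

lemma qq_power_eq_iff [simp]: "qq ^ m = qq ^ l \<longleftrightarrow> m = l"
  by (auto simp: qq_power eq_fract monom_eq_iff')

lemma qq_nonzero [simp]: "qq \<noteq> 0"
  by (simp add: qq_def Zero_fract_def eq_fract)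

lemma q_pochhammer_qq_nonzero: "q_pochhammer qq qq m \<noteq> 0"
proof -
  have "1 - qq * qq ^ i \<noteq> 0" for i
    using qq_power_eq_iff[of 0 "Suc i"] by (simp del: qq_power_eq_iff)
  then show ?thesis by (simp add: q_pochhammer_def)
qed

text \<open>The principal specialization, now with division: the q-Pochhammer symbol in the
  denominator is nonzero because distinct powers of \<open>qq\<close> differ.\<close>

lemma q_binomial_qq_eq_complete_homogeneous:
  "q_binomial qq (int r + int m) (int m) = complete_homogeneous r (map ((^) qq) [0..<Suc m])"
proof -
  have "q_binomial qq (int r + int m) (int m) = q_pochhammer (qq ^ Suc r) qq m / q_pochhammer qq qq m"
    using power_int_of_nat[of qq "Suc r"] by (simp add: q_binomial_def add.commute)
  then show ?thesis
    using q_pochhammer_qq_nonzero[of m] complete_homogeneous_powers[of qq m r]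
    by (metis nonzero_mult_div_cancel_left)
qed

section \<open>Factors of the q-Dyson product and their residues\<close>

text \<open>The two q-Pochhammer symbols belonging to a pair of indices. The \<open>of_bool\<close>
  terms put the extra factor q on the quotient whose numerator has the larger index, whichever of
  \<open>i\<close> and \<open>l\<close> that is. The expression is thus symmetric, and any index can
  be singled out.\<close>

definition pair_factor :: "(nat \<Rightarrow> nat) \<Rightarrow> nat \<Rightarrow> nat \<Rightarrow> laurent" where
  "pair_factor a i l =
     (\<Prod>s<a i. 1 - scalar (qq ^ (s + of_bool (l < i))) * (xpow i 1 * xpow l (- 1))) *
     (\<Prod>t<a l. 1 - scalar (qq ^ (t + of_bool (i < l))) * (xpow l 1 * xpow i (- 1)))"

lemma pair_factor_commute: "pair_factor a i l = pair_factor a l i"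
  by (simp add: pair_factor_def mult.commute)

definition dyson :: "nat \<Rightarrow> (nat \<Rightarrow> nat) \<Rightarrow> laurent" where
  "dyson n a = (\<Prod>j<n. \<Prod>i<j. pair_factor a i j)"

text \<open>\<open>pair_factor a i l\<close> divided by the factors \<open>1 - w x\<^sub>l q\<^sup>t\<close> with \<open>t < a l\<close>,
  at \<open>w = 1 / (x\<^sub>i q\<^sup>j)\<close>; the quotient contains no negative power of \<open>x\<^sub>i\<close>.\<close>

definition residue_factor :: "(nat \<Rightarrow> nat) \<Rightarrow> nat \<Rightarrow> nat \<Rightarrow> nat \<Rightarrow> laurent" where
  "residue_factor a i j l =
     (\<Prod>s=of_bool (l < i)..<Suc j. scalar (qq ^ a l) - scalar (qq ^ s) * (xpow i 1 * xpow l (- 1))) *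
     (\<Prod>s=Suc j..<a i + of_bool (l < i). 1 - scalar (qq ^ s) * (xpow i 1 * xpow l (- 1)))"

text \<open>Since \<open>U\<close> is the inverse of \<open>W\<close>, both sides equal -W times the
  product of \<open>1 - q ^ t * U\<close> over t from 0 to b.\<close>

lemma shift_product:
  fixes q W U :: "'a::comm_ring_1"
  assumes "W * U = 1"
  shows "(q ^ b - W) * (\<Prod>t<b. 1 - q ^ t * U) = (1 - W) * (\<Prod>t<b. 1 - q ^ Suc t * U)"
proof (induction b)
  case (Suc b)
  have "(q ^ Suc b - W) * (1 - q ^ b * U) = (q ^ b - W) * (1 - q ^ Suc b * U)"
  proof -
    have "W * (q ^ m * U) = q ^ m" for m
      using assms by (metis mult.left_commute mult.right_neutral)
    then show ?thesis by (simp only: left_diff_distrib right_diff_distrib mult.right_neutral mult_1_left)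
      (simp add: algebra_simps)
  qed
  then have "(q ^ Suc b - W) * (1 - q ^ b * U) * (\<Prod>t<b. 1 - q ^ t * U)
      = (q ^ b - W) * (1 - q ^ Suc b * U) * (\<Prod>t<b. 1 - q ^ t * U)"
    by simp
  then have "(q ^ Suc b - W) * (\<Prod>t<Suc b. 1 - q ^ t * U)
      = ((q ^ b - W) * (\<Prod>t<b. 1 - q ^ t * U)) * (1 - q ^ Suc b * U)"
    by (simp only: prod.lessThan_Suc ac_simps)
  then show ?case by (simp only: Suc.IH prod.lessThan_Suc mult.assoc)
qed simp

text \<open>Iterates \<open>shift_product\<close> with W = q^s w and U = p^s u, where
  \<open>p\<close> is the inverse of \<open>q\<close>; each step lowers the exponent of
  \<open>p\<close> by one.\<close>

lemma shift_products:
  fixes q p w u :: "'a::comm_ring_1"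
  assumes qp: "q * p = 1" and wu: "w * u = 1"
  shows "(\<Prod>s=e..<e+m. q ^ b - q ^ s * w) * (\<Prod>t<b. 1 - q ^ Suc t * p ^ (e + m) * u)
    = (\<Prod>s=e..<e+m. 1 - q ^ s * w) * (\<Prod>t<b. 1 - q ^ Suc t * p ^ e * u)"
proof (induction m)
  case (Suc m)
  define s where "s = e + m"
  have qps: "q ^ n * p ^ n = 1" for n by (simp add: qp flip: power_mult_distrib)
  have "(q ^ s * w) * (p ^ s * u) = (q ^ s * p ^ s) * (w * u)" by (simp add: ac_simps)
  then have WU: "(q ^ s * w) * (p ^ s * u) = 1" by (simp add: qps wu)
  have "q ^ Suc t * p ^ Suc s * u = q ^ t * (p ^ s * u)" for t
  proof -
    have "q ^ Suc t * p ^ Suc s * u = (q * p) * (q ^ t * (p ^ s * u))" by (simp add: ac_simps)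
    then show ?thesis by (simp add: qp)
  qed
  then have "(q ^ b - q ^ s * w) * (\<Prod>t<b. 1 - q ^ Suc t * p ^ Suc s * u)
      = (1 - q ^ s * w) * (\<Prod>t<b. 1 - q ^ Suc t * p ^ s * u)"
    using shift_product[OF WU, of q b] by (simp add: mult.assoc)
  then have "(\<Prod>s=e..<e+Suc m. q ^ b - q ^ s * w) * (\<Prod>t<b. 1 - q ^ Suc t * p ^ (e + Suc m) * u)
     = (\<Prod>s=e..<e+m. q ^ b - q ^ s * w) * ((1 - q ^ s * w) * (\<Prod>t<b. 1 - q ^ Suc t * p ^ s * u))"
    by (simp add: s_def mult.assoc)
  also have "\<dots> = (1 - q ^ s * w) * ((\<Prod>s=e..<e+m. q ^ b - q ^ s * w)
        * (\<Prod>t<b. 1 - q ^ Suc t * p ^ s * u))"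
    by (simp only: ac_simps)
  also have "\<dots> = (1 - q ^ s * w) * ((\<Prod>s=e..<e+m. 1 - q ^ s * w) * (\<Prod>t<b. 1 - q ^ Suc t * p ^ e * u))"
    using Suc.IH by (simp only: s_def)
  finally show ?case by (simp add: s_def ac_simps)
qed simp

text \<open>The letters x_l q^t contribute the factors 1 - q^(t-j) x_l / x_i. Shifting their
  exponents upwards by \<open>shift_products\<close> turns them into the factors of
  \<open>pair_factor\<close> with x_i in the denominator, while the first product of
  \<open>residue_factor\<close> becomes the missing part of those with x_i in the numerator.\<close>

lemma residue_factor_mult:
  assumes "i \<noteq> l" "j < a i"
  shows "residue_factor a i j l *
    (\<Prod>t<a l. 1 - (xpow l 1 * scalar (qq ^ t)) * (xpow i (- 1) * scalar (inverse qq ^ j))) =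
    pair_factor a i l"
proof -
  define e :: nat where "e = of_bool (l < i)"
  define w where "w = xpow i 1 * xpow l (- 1)"
  define u where "u = xpow l 1 * xpow i (- 1)"
  define q where "q = scalar qq"
  define p where "p = scalar (inverse qq)"
  have e: "e \<le> Suc j" by (simp add: e_def)
  have qp: "q * p = 1" by (simp add: q_def p_def scalar_mult[symmetric])
  have inv: "xpow m 1 * xpow m (- 1) = 1" for m by (simp add: xpow_add[symmetric])
  have "w * u = (xpow i 1 * xpow i (- 1)) * (xpow l 1 * xpow l (- 1))"
    by (simp only: w_def u_def ac_simps)
  then have wu: "w * u = 1" by (simp add: inv)
  \<comment> \<open>The exponent t - j is written as (t + 1) - (j + 1), because the shift runs over
    \<open>s\<close> from \<open>e\<close> up to and including \<open>j\<close>.\<close>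
  have factor: "(xpow l 1 * scalar (qq ^ t)) * (xpow i (- 1) * scalar (inverse qq ^ j))
      = q ^ Suc t * p ^ (e + (Suc j - e)) * u" for t
  proof -
    have "q ^ Suc t * p ^ (e + (Suc j - e)) * u = (q * p) * (q ^ t * p ^ j * u)"
      using e by (simp add: ac_simps)
    then have "q ^ Suc t * p ^ (e + (Suc j - e)) * u = q ^ t * p ^ j * u" by (simp only: qp mult_1_left)
    then show ?thesis by (simp only: scalar_power q_def p_def u_def ac_simps)
  qed
  have shift: "(\<Prod>s=e..<Suc j. q ^ a l - q ^ s * w) * (\<Prod>t<a l. 1 - q ^ Suc t * p ^ (e + (Suc j - e)) * u)
    = (\<Prod>s=e..<Suc j. 1 - q ^ s * w) * (\<Prod>t<a l. 1 - q ^ Suc t * p ^ e * u)"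
    using shift_products[OF qp wu, where e = e and m = "Suc j - e" and b = "a l"]
    by (simp only: le_add_diff_inverse[OF e])
  \<comment> \<open>The shift stops at \<open>p ^ e\<close>, which leaves exactly the extra power of
    q prescribed by the order of \<open>i\<close> and \<open>l\<close>.\<close>
  have exponent: "q ^ Suc t * p ^ e = q ^ (t + of_bool (i < l))" for t
  proof (cases "l < i")
    case True
    then have "q ^ Suc t * p ^ e = (q * p) * q ^ t" by (simp add: e_def ac_simps)
    then show ?thesis using True by (simp add: qp)
  qed (use assms in \<open>simp add: e_def\<close>)
  have join: "(\<Prod>s=e..<Suc j. 1 - q ^ s * w) * (\<Prod>s=Suc j..<a i + e. 1 - q ^ s * w)
      = (\<Prod>s<a i. 1 - q ^ (s + e) * w)"
  proof -
    have "(\<Prod>s=e..<Suc j. 1 - q ^ s * w) * (\<Prod>s=Suc j..<a i + e. 1 - q ^ s * w)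
       = (\<Prod>s=0 + e..<a i + e. 1 - q ^ s * w)"
      using assms by (simp only: prod.atLeastLessThan_concat[OF e] add_0)
    also have "\<dots> = (\<Prod>s<a i. 1 - q ^ (s + e) * w)"
      by (subst prod.shift_bounds_nat_ivl) (simp add: lessThan_atLeast0)
    finally show ?thesis .
  qed
  have "((\<Prod>s=e..<Suc j. q ^ a l - q ^ s * w) *
      (\<Prod>t<a l. 1 - (xpow l 1 * scalar (qq ^ t)) * (xpow i (- 1) * scalar (inverse qq ^ j)))) *
      (\<Prod>s=Suc j..<a i + e. 1 - q ^ s * w)
    = ((\<Prod>s=e..<Suc j. 1 - q ^ s * w) * (\<Prod>s=Suc j..<a i + e. 1 - q ^ s * w)) *
      (\<Prod>t<a l. 1 - q ^ (t + of_bool (i < l)) * u)"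
    unfolding factor shift exponent by (simp only: ac_simps)
  also have "\<dots> = (\<Prod>s<a i. 1 - q ^ (s + e) * w) * (\<Prod>t<a l. 1 - q ^ (t + of_bool (i < l)) * u)"
    by (simp only: join)
  finally show ?thesis
    unfolding residue_factor_def pair_factor_def e_def[symmetric] w_def[symmetric] u_def[symmetric]
      scalar_power q_def[symmetric]
    by (simp only: ac_simps)
qed

lemma ord_ge_residue_factor: "i \<noteq> l \<Longrightarrow> ord_ge i 0 (residue_factor a i j l)"
  unfolding residue_factor_def
  by (intro ord_ge_mult_0 ord_ge_prod ord_ge_diff ord_ge_scalar ord_ge_one ord_ge_xpow) auto

text \<open>At \<open>x_k = 0\<close> each factor of the first product becomes q to the power a_l,
  with l standing for \<open>skip k l\<close>, and each factor of the second becomes 1. The first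
  product has j + 1 factors if k < l and j otherwise; the surplus factor is the source of the power
  of q in the theorem.\<close>

lemma drop_var_residue_factor:
  "drop_var k (residue_factor a k j (skip k l)) = scalar (qq ^ (a (skip k l) * (j + of_bool (k < skip k l))))"
proof -
  have ord: "ord_ge k 0 (xpow k 1)" "ord_ge k 0 (xpow (skip k l) (- 1))"
    by (simp_all add: ord_ge_xpow)
  have 0: "drop_var k (scalar c * (xpow k 1 * xpow (skip k l) (- 1))) = 0" for c
    using ord by (simp add: drop_var_mult ord_ge_mult_0)
  have "Suc j - of_bool (skip k l < k) = j + of_bool (k < skip k l)"
    by (cases "k < skip k l") (auto simp: skip_def split: if_splits)
  then show ?thesis
    unfolding residue_factor_def
    by (subst drop_var_mult drop_var_prod;
        (intro ord_ge_mult_0 ord_ge_prod ord_ge_diff ord_ge_scalar ord_ge_one ord)?)+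
      (simp add: drop_var_diff 0 scalar_power[symmetric] power_mult)
qed

lemma ord_ge_pair_factor: "i \<noteq> k \<Longrightarrow> l \<noteq> k \<Longrightarrow> ord_ge k 0 (pair_factor a i l)"
  unfolding pair_factor_def
  by (intro ord_ge_mult_0 ord_ge_prod ord_ge_diff ord_ge_scalar ord_ge_one ord_ge_xpow) auto

lemma drop_var_pair_factor:
  "drop_var k (pair_factor a (skip k i) (skip k l)) = pair_factor (a \<circ> skip k) i l"
proof -
  have ord: "ord_ge k 0 (xpow (skip k m) r)" for m r
    by (simp add: ord_ge_xpow)
  show ?thesis
    unfolding pair_factor_def
    by (subst drop_var_mult drop_var_prod;
        (intro ord_ge_mult_0 ord_ge_prod ord_ge_diff ord_ge_scalar ord_ge_one ord)?)+
      (simp add: drop_var_diff drop_var_mult ord ord_ge_mult_0)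
qed

lemma drop_var_dyson:
  "drop_var k (\<Prod>j<n. \<Prod>i<j. pair_factor a (skip k i) (skip k j)) = dyson n (a \<circ> skip k)"
proof -
  have ord: "ord_ge k 0 (pair_factor a (skip k i) (skip k j))" for i j
    by (simp add: ord_ge_pair_factor)
  show ?thesis
    by (simp add: dyson_def drop_var_prod ord_ge_prod ord drop_var_pair_factor)
qed

section \<open>Partial fractions in q alone\<close>

text \<open>The coefficient of 1 / (1 - w q^j) in the expansion of the reciprocal of (w;
  q)_m.\<close>

definition partial_fraction_weight :: "nat \<Rightarrow> nat \<Rightarrow> ratfun" where
  "partial_fraction_weight m j = inverse (\<Prod>t\<in>{..<m} - {j}. 1 - qq ^ t * inverse qq ^ j)"

lemma partial_fraction_weight_mult:
  "partial_fraction_weight m j * (\<Prod>t\<in>{..<m} - {j}. 1 - qq ^ t * inverse qq ^ j) = 1"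
proof -
  have "1 - qq ^ t * inverse qq ^ j \<noteq> 0" if "t \<noteq> j" for t
    using that by (simp add: power_inverse field_simps)
  then have "(\<Prod>t\<in>{..<m} - {j}. 1 - qq ^ t * inverse qq ^ j) \<noteq> 0" by simp
  then show ?thesis by (simp add: partial_fraction_weight_def)
qed

text \<open>The partial fraction expansion is read backwards, with c = 1 and the letters 1, q, ...,
  q^(m-1).\<close>

lemma sum_partial_fraction_weight:
  assumes "m > 0"
  shows "(\<Sum>j<m. partial_fraction_weight m j * (qq ^ j) ^ r) = q_binomial qq (int r + int m - 1) (int m - 1)"
proof -
  have "1 * complete_homogeneous r (map ((^) qq) [0..<m])
    = (\<Sum>j\<in>set [0..<m]. partial_fraction_weight m j * (qq ^ j) ^ r)"
  proof (rule complete_homogeneous_partial_fractions[where z = "\<lambda>j. inverse qq ^ j"])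
    show "partial_fraction_weight m j * (\<Prod>t\<in>set [0..<m] - {j}. 1 - qq ^ t * inverse qq ^ j) = 1" for j
      using partial_fraction_weight_mult[of m j] by (simp add: lessThan_atLeast0)
  qed (use assms in \<open>auto simp: inj_on_def simp flip: power_mult_distrib\<close>)
  moreover have "q_binomial qq (int r + int m - 1) (int m - 1) = complete_homogeneous r (map ((^) qq) [0..<m])"
    using q_binomial_qq_eq_complete_homogeneous[of r "m - 1"] assms by (simp add: of_nat_diff add_diff_eq)
  ultimately show ?thesis by (simp add: lessThan_atLeast0)
qed

section \<open>Rearranging and omitting entries\<close>

lemma complete_homogeneous_part_mset:
  "mset xs = mset ys \<Longrightarrow> complete_homogeneous_part xs zs = complete_homogeneous_part ys zs"
  unfolding complete_homogeneous_part_def by (metis mset_map prod_mset_prod_list)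

lemma mset_omit: "k < length v \<Longrightarrow> mset v = add_mset (v ! k) (mset (omit k v))"
  by (subst id_take_nth_drop[of k v]) (auto simp: omit_def)

lemma length_omit: "k < length v \<Longrightarrow> length (omit k v) = length v - 1"
  by (simp add: omit_def)

lemma nth_omit: "k < length v \<Longrightarrow> i < length v - 1 \<Longrightarrow> omit k v ! i = v ! skip k i"
  by (auto simp: omit_def nth_append skip_def)

lemma D_eq:
  "D v lam a = constant_term ((\<Prod>i<length v. xpow i (- (v ! i))) *
     complete_homogeneous_part lam (alphabet a) * dyson (length a) ((!) a))"
proof -
  have "q_pochhammer (xpow i 1 * xpow j (- 1)) (scalar qq) (a ! i) *
        q_pochhammer (scalar qq * xpow j 1 * xpow i (- 1)) (scalar qq) (a ! j) = pair_factor ((!) a) i j"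
    if "i < j" for i j
    using that by (simp add: q_pochhammer_def pair_factor_def scalar_power scalar_mult ac_simps)
  then have "(\<Prod>j<length a. \<Prod>i<j. q_pochhammer (xpow i 1 * xpow j (- 1)) (scalar qq) (a ! i) *
        q_pochhammer (scalar qq * xpow j 1 * xpow i (- 1)) (scalar qq) (a ! j)) = dyson (length a) ((!) a)"
    unfolding dyson_def by (intro prod.cong) auto
  then show ?thesis by (simp add: D_def)
qed

subsection \<open>Residues of the generating function\<close>

text \<open>The coefficient of 1 / (1 - w x_i q^j) in the expansion of the generating function.
  Letters with the same x_i give the scalar weight, pairs containing \<open>i\<close> lose their
  denominators, and the remaining pairs are untouched.\<close>

definition residue :: "nat \<Rightarrow> (nat \<Rightarrow> nat) \<Rightarrow> nat \<Rightarrow> nat \<Rightarrow> laurent" where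
  "residue n a i j = scalar (partial_fraction_weight (a i) j) *
     (\<Prod>l<n. residue_factor a i j (skip i l)) *
     (\<Prod>m<n. \<Prod>l<m. pair_factor a (skip i l) (skip i m))"

text \<open>This is the condition on \<open>B\<close> in
  \<open>complete_homogeneous_partial_fractions\<close>: the product over all letters except x_i
  q^j, evaluated at w = 1 / (x_i q^j), splits into the letters with the same x_i and those with
  another variable.\<close>

lemma residue_mult:
  assumes "i \<le> n" "j < a i"
  shows "residue n a i j * (\<Prod>p\<in>(SIGMA l:{..<Suc n}. {..<a l}) - {(i, j)}.
      1 - (xpow (fst p) 1 * scalar (qq ^ snd p)) * (xpow i (- 1) * scalar (inverse qq ^ j))) = dyson (Suc n) a"
proof -
  define g where "g l t = 1 - (xpow l 1 * scalar (qq ^ t)) * (xpow i (- 1) * scalar (inverse qq ^ j))" for l t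
  have eq: "(SIGMA l:{..<Suc n}. {..<a l}) - {(i, j)}
      = Pair i ` ({..<a i} - {j}) \<union> (SIGMA l:{..<Suc n} - {i}. {..<a l})"
    using assms by auto
  have "(\<Prod>p\<in>(SIGMA l:{..<Suc n}. {..<a l}) - {(i, j)}. g (fst p) (snd p))
     = (\<Prod>p\<in>Pair i ` ({..<a i} - {j}). g (fst p) (snd p)) *
       (\<Prod>p\<in>(SIGMA l:{..<Suc n} - {i}. {..<a l}). g (fst p) (snd p))"
    unfolding eq by (rule prod.union_disjoint) auto
  also have "(\<Prod>p\<in>Pair i ` ({..<a i} - {j}). g (fst p) (snd p)) = (\<Prod>t\<in>{..<a i} - {j}. g i t)"
    by (subst prod.reindex) (auto simp: inj_on_def)
  also have "\<dots> = scalar (\<Prod>t\<in>{..<a i} - {j}. 1 - qq ^ t * inverse qq ^ j)"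
  proof -
    have "g i t = scalar (1 - qq ^ t * inverse qq ^ j)" for t
    proof -
      have "(xpow i 1 * scalar (qq ^ t)) * (xpow i (- 1) * scalar (inverse qq ^ j))
        = (xpow i 1 * xpow i (- 1)) * (scalar (qq ^ t) * scalar (inverse qq ^ j))"
        by (simp only: ac_simps)
      then show ?thesis by (simp add: g_def scalar_diff scalar_mult xpow_add[symmetric])
    qed
    then show ?thesis by (simp add: scalar_prod)
  qed
  also have "(\<Prod>p\<in>(SIGMA l:{..<Suc n} - {i}. {..<a l}). g (fst p) (snd p))
     = (\<Prod>l\<in>{..<Suc n} - {i}. \<Prod>t<a l. g l t)"
    by (subst prod.Sigma) (simp_all add: split_def)
  also have "\<dots> = (\<Prod>l<n. \<Prod>t<a (skip i l). g (skip i l) t)"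
    unfolding image_skip[OF assms(1), symmetric] by (subst prod.reindex) (auto simp: inj_on_def)
  finally have "residue n a i j * (\<Prod>p\<in>(SIGMA l:{..<Suc n}. {..<a l}) - {(i, j)}. g (fst p) (snd p))
     = (scalar (partial_fraction_weight (a i) j) * scalar (\<Prod>t\<in>{..<a i} - {j}. 1 - qq ^ t * inverse qq ^ j)) *
       (\<Prod>l<n. residue_factor a i j (skip i l) * (\<Prod>t<a (skip i l). g (skip i l) t)) *
       (\<Prod>m<n. \<Prod>l<m. pair_factor a (skip i l) (skip i m))"
    by (simp only: residue_def prod.distrib ac_simps)
  also have "\<dots> = (\<Prod>l<n. pair_factor a i (skip i l)) *
      (\<Prod>m<n. \<Prod>l<m. pair_factor a (skip i l) (skip i m))"
    using assms by (simp add: scalar_mult[symmetric] partial_fraction_weight_mult g_def residue_factor_mult)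
  also have "\<dots> = dyson (Suc n) a"
    unfolding dyson_def by (rule prod_pairs_skip[OF assms(1) pair_factor_commute, symmetric])
  finally show ?thesis by (simp add: g_def)
qed

lemma ord_ge_residue: "ord_ge i 0 (residue n a i j)"
  unfolding residue_def
  by (intro ord_ge_mult_0 ord_ge_scalar ord_ge_prod ord_ge_residue_factor ord_ge_pair_factor) auto

lemma drop_var_residue:
  "drop_var k (residue n a k j) = scalar (partial_fraction_weight (a k) j *
     qq ^ (\<Sum>l<n. a (skip k l) * (j + of_bool (k < skip k l)))) * dyson n (a \<circ> skip k)"
proof -
  have "drop_var k (\<Prod>l<n. residue_factor a k j (skip k l))
     = (\<Prod>l<n. scalar (qq ^ (a (skip k l) * (j + of_bool (k < skip k l)))))"
    by (simp add: drop_var_prod ord_ge_residue_factor drop_var_residue_factor)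
  moreover have "ord_ge k 0 (\<Prod>l<n. residue_factor a k j (skip k l))"
    by (intro ord_ge_prod ord_ge_residue_factor) auto
  moreover have "ord_ge k 0 (\<Prod>m<n. \<Prod>l<m. pair_factor a (skip k l) (skip k m))"
    by (intro ord_ge_prod ord_ge_pair_factor) auto
  ultimately show ?thesis
    by (simp add: residue_def drop_var_mult ord_ge_mult_0 drop_var_dyson scalar_mult power_sum scalar_prod)
qed

section \<open>The alphabet and the expansion of the generating function\<close>

lemma alphabet_eq: "alphabet a = map (\<lambda>p. xpow (fst p) 1 * scalar (qq ^ snd p))
    (concat (map (\<lambda>i. map (Pair i) [0..<a ! i]) [0..<length a]))"
  by (simp add: alphabet_def map_concat o_def)

lemma dyson_complete_homogeneous:
  assumes len: "length a = Suc n" and nontriv: "alphabet a \<noteq> [] \<or> r > 0"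
  shows "dyson (Suc n) ((!) a) * complete_homogeneous r (alphabet a) =
    (\<Sum>i<Suc n. \<Sum>j<a ! i. residue n ((!) a) i j * (xpow i 1 * scalar (qq ^ j)) ^ r)"
proof -
  define ps where "ps = concat (map (\<lambda>i. map (Pair i) [0..<a ! i]) [0..<length a])"
  define y where "y p = xpow (fst p) 1 * scalar (qq ^ snd p)" for p :: "nat \<times> nat"
  have set: "set ps = (SIGMA i:{..<Suc n}. {..<a ! i})"
    by (auto simp: ps_def len simp del: upt_Suc)
  have "distinct ps"
  proof -
    have "distinct (concat (map (\<lambda>i. map (Pair i) [0..<a ! i]) xs))" if "distinct xs" for xs
      using that by (induction xs) (auto simp: distinct_map inj_on_def)
    then show ?thesis by (simp add: ps_def)
  qed
  \<comment> \<open>A letter is a monomial: its exponent vector reveals \<open>i\<close>, and its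
    coefficient q^j reveals \<open>j\<close>.\<close>
  moreover have "inj_on y (set ps)"
  proof (rule inj_onI)
    fix p p' assume eq: "y p = y p'"
    have y: "y p = Poly_Mapping.single (Poly_Mapping.single (fst p) 1) (qq ^ snd p)" for p
      by (simp add: y_def xpow_def scalar_def mult_single)
    have l: "Poly_Mapping.lookup (y p) (Poly_Mapping.single (fst p) 1) = qq ^ snd p" for p
      by (simp add: y)
    have "Poly_Mapping.keys (y p) = Poly_Mapping.keys (y p')" using eq by simp
    then have "Poly_Mapping.keys (Poly_Mapping.single (fst p) (1::int)) = Poly_Mapping.keys (Poly_Mapping.single (fst p') (1::int))"
      by (simp add: y)
    then have "fst p = fst p'" by simp
    moreover have "snd p = snd p'" using l[of p] l[of p'] eq \<open>fst p = fst p'\<close> by simp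
    ultimately show "p = p'" by (simp add: prod_eq_iff)
  qed
  moreover have "y p * (xpow (fst p) (- 1) * scalar (inverse qq ^ snd p)) = 1" for p
  proof -
    have "y p * (xpow (fst p) (- 1) * scalar (inverse qq ^ snd p))
      = (xpow (fst p) 1 * xpow (fst p) (- 1)) * (scalar (qq ^ snd p) * scalar (inverse qq ^ snd p))"
      by (simp only: y_def ac_simps)
    then show ?thesis by (simp add: xpow_add[symmetric] scalar_mult[symmetric] flip: power_mult_distrib)
  qed
  moreover have "residue n ((!) a) (fst p) (snd p) *
      (\<Prod>p'\<in>set ps - {p}. 1 - y p' * (xpow (fst p) (- 1) * scalar (inverse qq ^ snd p))) = dyson (Suc n) ((!) a)"
    if "p \<in> set ps" for p
    using that residue_mult[of "fst p" n "snd p" "(!) a"] by (auto simp: set y_def)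
  moreover have "ps \<noteq> [] \<or> r > 0" using nontriv by (auto simp: alphabet_eq ps_def)
  ultimately have "dyson (Suc n) ((!) a) * complete_homogeneous r (map y ps)
      = (\<Sum>p\<in>set ps. residue n ((!) a) (fst p) (snd p) * y p ^ r)"
    by (rule complete_homogeneous_partial_fractions)
  also have "\<dots> = (\<Sum>i<Suc n. \<Sum>j<a ! i. residue n ((!) a) i j * (xpow i 1 * scalar (qq ^ j)) ^ r)"
    unfolding set y_def by (subst sum.Sigma) (simp_all add: split_def)
  finally show ?thesis by (simp only: alphabet_eq ps_def y_def[abs_def])
qed

lemma ord_ge_alphabet: "y \<in> set (alphabet a) \<Longrightarrow> ord_ge k 0 y"
  by (auto simp: alphabet_def intro!: ord_ge_mult_0 ord_ge_xpow)

text \<open>Substituting \<open>x_k = 0\<close> sends the letters in x_k to 0 and renumbers the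
  variables of the others, so the surviving letters are those of the shortened sequence, in the same
  order.\<close>

lemma filter_drop_var_alphabet:
  assumes "k < length a"
  shows "filter (\<lambda>y. y \<noteq> 0) (map (drop_var k) (alphabet a)) = alphabet (omit k a)"
proof -
  obtain n where n: "length a = Suc n" and k: "k \<le> n"
    using assms by (cases "length a") auto
  define G where "G i = filter (\<lambda>y. y \<noteq> 0) (map (drop_var k) (map (\<lambda>j. xpow i 1 * scalar (qq ^ j)) [0..<a ! i]))" for i
  have nz: "xpow i 1 * scalar (qq ^ j) \<noteq> 0" for i j
    by (simp add: xpow_def scalar_def mult_single flip: keys_eq_empty)
  have Gk: "G k = []"
    by (auto simp: G_def filter_empty_conv drop_var_mult ord_ge_xpow)
  have Gskip: "G (skip k i) = map (\<lambda>j. xpow i 1 * scalar (qq ^ j)) [0..<a ! skip k i]" for i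
  proof -
    have eq: "drop_var k (xpow (skip k i) 1 * scalar c) = xpow i 1 * scalar c" for c
      by (simp add: drop_var_mult ord_ge_xpow)
    show ?thesis unfolding G_def map_map o_def eq by (simp add: filter_map o_def nz del: mult_eq_0_iff)
  qed
  have "[0..<Suc n] = map (skip k) [0..<k] @ [k] @ map (skip k) [k..<n]"
  proof -
    have "map (skip k) [0..<k] = [0..<k]" by (rule map_idI) (simp add: skip_def)
    moreover have "map (skip k) [k..<n] = [Suc k..<Suc n]"
      unfolding map_Suc_upt[symmetric] by (rule map_cong) (auto simp: skip_def)
    ultimately show ?thesis
      using k upt_add_eq_append[of 0 k "Suc n - k"] by (simp add: upt_conv_Cons del: upt_Suc)
  qed
  then have "concat (map G [0..<Suc n]) = concat (map (\<lambda>i. G (skip k i)) ([0..<k] @ [k..<n]))"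
    by (simp add: Gk o_def del: upt_Suc)
  also have "[0..<k] @ [k..<n] = [0..<n]"
    using k upt_add_eq_append[of 0 k "n - k"] by simp
  finally have "concat (map G [0..<Suc n])
      = concat (map (\<lambda>i. map (\<lambda>j. xpow i 1 * scalar (qq ^ j)) [0..<a ! skip k i]) [0..<n])"
    by (simp only: Gskip)
  moreover have "filter (\<lambda>y. y \<noteq> 0) (map (drop_var k) (alphabet a)) = concat (map G [0..<Suc n])"
    by (simp only: alphabet_def map_concat filter_concat map_map o_def G_def[abs_def] n)
  moreover have "alphabet (omit k a)
      = concat (map (\<lambda>i. map (\<lambda>j. xpow i 1 * scalar (qq ^ j)) [0..<a ! skip k i]) [0..<n])"
    using assms by (auto simp: alphabet_def length_omit nth_omit n intro!: arg_cong[of _ _ concat])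
  ultimately show ?thesis by simp
qed

lemma ord_ge_complete_homogeneous_part: "ord_ge k 0 (complete_homogeneous_part lam (alphabet a))"
  by (induction lam)
    (auto simp: complete_homogeneous_part_def
      intro!: ord_ge_mult_0 ord_ge_complete_homogeneous[OF ord_ge_alphabet])

lemma drop_var_complete_homogeneous_part:
  assumes "k < length a"
  shows "drop_var k (complete_homogeneous_part lam (alphabet a)) =
    complete_homogeneous_part lam (alphabet (omit k a))"
proof (induction lam)
  case (Cons r lam)
  have "drop_var k (complete_homogeneous r (alphabet a)) = complete_homogeneous r (alphabet (omit k a))"
    using filter_drop_var_alphabet[OF assms]
    by (simp add: drop_var_complete_homogeneous ord_ge_alphabet)
      (metis complete_homogeneous_filter_nonzero)
  moreover have "drop_var k (complete_homogeneous r (alphabet a) * complete_homogeneous_part lam (alphabet a))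
     = drop_var k (complete_homogeneous r (alphabet a)) * drop_var k (complete_homogeneous_part lam (alphabet a))"
    by (intro drop_var_mult ord_ge_complete_homogeneous_part ord_ge_complete_homogeneous[OF ord_ge_alphabet])
  ultimately show ?case using Cons.IH by (simp add: complete_homogeneous_part_def)
qed (simp add: complete_homogeneous_part_def)

lemma dyson_cong: "(\<And>i. i < n \<Longrightarrow> a i = b i) \<Longrightarrow> dyson n a = dyson n b"
  by (auto simp: dyson_def pair_factor_def intro!: prod.cong)

section \<open>The recursion for the constant terms\<close>

theorem theorem1p3:
  fixes n k :: nat and a v :: "nat list"
  assumes "length a = n + 1" and "length v = n + 1"
    and "count_list v (Max (set v)) = 1"
    and "k \<le> n" and "v ! k = Max (set v)"
    and "\<not> (n = 0 \<and> v ! 0 = 0 \<and> a ! 0 = 0)"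
  shows "D (map int v) (decreasing v) a =
    qq ^ (\<Sum>i=k+1..n. a ! i) *
    q_binomial qq (int (v ! k) + int (sum_list a) - 1) (int (a ! k) - 1) *
    D (map int (omit k v)) (decreasing (omit k v)) (omit k a)"
proof -
  define M where "M = v ! k"
  define lam where "lam = decreasing (omit k v)"
  define R where "R = complete_homogeneous_part lam (alphabet a)"
  define X where "X i = (\<Prod>l<n. xpow (skip i l) (- int (v ! skip i l)))" for i
  \<comment> \<open>The contribution of the letter x_i q^j, stripped of its scalar and of all powers
    of x_i outside \<open>R\<close> and the residue; what remains is regular in x_i.\<close>
  define T where "T i j = X i * R * residue n ((!) a) i j" for i j
  define B where "B = (\<Sum>i=k+1..n. a ! i)"
  define A where "A = (\<Sum>l<n. a ! skip k l)"
  define D' where "D' = D (map int (omit k v)) lam (omit k a)"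
  have kv: "k < length v" and ka: "k < length a" using assms by auto

  \<comment> \<open>Multiplicity one makes every other entry strictly smaller than the
    maximum.\<close>
  have "v ! k \<notin> set (omit k v)"
    using assms(3) mset_omit[OF kv] by (simp add: assms(5)[symmetric] count_mset[symmetric])
  then have less: "v ! i < M" if "i \<le> n" "i \<noteq> k" for i
  proof -
    have "i \<in> skip k ` {..<n}" using that assms(4) by (simp add: image_skip)
    then obtain l where l: "l < n" "i = skip k l" by auto
    then have "v ! i \<in> set (omit k v)"
      using kv assms(2) by (metis nth_omit length_omit nth_mem diff_add_inverse2)
    then have "v ! i \<noteq> v ! k" using \<open>v ! k \<notin> _\<close> by auto
    moreover have "v ! i \<le> v ! k" unfolding assms(5) using that assms(2) by (intro Max_ge) auto
    ultimately show ?thesis by (simp add: M_def)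
  qed
  \<comment> \<open>If the maximum is 0, a second entry would have to be negative, so n = 0, and the
    last assumption gives a_0 > 0. In the case excluded there, the left side is h_0 of the empty
    alphabet, which is 1, whereas the q-binomial coefficient has lower index -1 and is 0.\<close>
  have nontriv: "alphabet a \<noteq> [] \<or> M > 0"
  proof (cases "M = 0")
    case True
    have "n = 0"
    proof (rule ccontr)
      assume "n \<noteq> 0"
      then show False using True less[of 0] less[of 1] by (cases "k = 0") auto
    qed
    then have "a ! 0 \<noteq> 0" using assms True by (auto simp: M_def)
    then show ?thesis using \<open>n = 0\<close> assms(1) by (auto simp: alphabet_def)
  qed simp

  have "mset (decreasing v) = mset (M # lam)"
    using mset_omit[OF kv] by (simp add: decreasing_def lam_def M_def)
  then have part: "complete_homogeneous_part (decreasing v) (alphabet a) = complete_homogeneous M (alphabet a) * R"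
    using complete_homogeneous_part_mset[of "decreasing v" "M # lam"]
    by (simp add: complete_homogeneous_part_def R_def)
  have summand: "(\<Prod>i<Suc n. xpow i (- int (v ! i))) * R * (residue n ((!) a) i j * (xpow i 1 * scalar (qq ^ j)) ^ M)
     = scalar (qq ^ (j * M)) * (xpow i (int M - int (v ! i)) * T i j)" if "i < Suc n" for i j
  proof -
    have "(\<Prod>i<Suc n. xpow i (- int (v ! i))) = xpow i (- int (v ! i)) * X i"
      unfolding X_def using that by (intro prod.lessThan_Suc_skip) simp
    moreover have "(xpow i 1 * scalar (qq ^ j)) ^ M = xpow i (int M) * scalar (qq ^ (j * M))"
      by (simp add: power_mult_distrib xpow_power power_mult scalar_power)
    moreover have "xpow i (int M - int (v ! i)) = xpow i (int M) * xpow i (- int (v ! i))"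
      by (simp flip: xpow_add)
    ultimately show ?thesis by (simp only: T_def ac_simps)
  qed
  have ordT: "ord_ge i 0 (T i j)" for i j
    unfolding T_def X_def R_def
    by (intro ord_ge_mult_0 ord_ge_residue ord_ge_complete_homogeneous_part ord_ge_prod ord_ge_xpow) auto
  \<comment> \<open>The exponent M - v_i is positive for \<open>i\<close> other than
    \<open>k\<close>, so the whole term is divisible by x_i within the polynomials regular in
    x_i.\<close>
  have zero: "constant_term (xpow i (int M - int (v ! i)) * T i j) = 0" if "i < Suc n" "i \<noteq> k" for i j
  proof -
    have "ord_ge i (1 + 0) (xpow i (int M - int (v ! i)) * T i j)"
      using less[of i] that by (intro ord_ge_mult ordT ord_ge_xpow) auto
    then show ?thesis by (intro constant_term_ord_ge_1[of i]) simp
  qed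
  have B: "(\<Sum>l<n. a ! skip k l * of_bool (k < skip k l)) = B"
  proof -
    have "B = (\<Sum>i<Suc n. a ! i * of_bool (k < i))"
      unfolding B_def by (intro sum.mono_neutral_cong_left) auto
    then show ?thesis using sum.lessThan_Suc_skip[OF assms(4), of "\<lambda>i. a ! i * of_bool (k < i)"] by simp
  qed
  \<comment> \<open>For i = k the powers of x_k cancel, so x_k may be set to 0 in each factor; the
    monomial, \<open>R\<close> and the residue become the data of the shortened sequences.\<close>
  have CTk: "constant_term (T k j) = partial_fraction_weight (a ! k) j * qq ^ (j * A + B) * D'" for j
  proof -
    have "drop_var k (X k) = (\<Prod>l<n. xpow l (- int (v ! skip k l)))"
      unfolding X_def by (subst drop_var_prod) (auto intro: ord_ge_xpow)
    also have "\<dots> = (\<Prod>l<length (map int (omit k v)). xpow l (- (map int (omit k v) ! l)))"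
      using kv assms(2) by (intro prod.cong) (auto simp: length_omit nth_omit)
    finally have dX: "drop_var k (X k) = \<dots>" .
    have dR: "drop_var k R = complete_homogeneous_part lam (alphabet (omit k a))"
      unfolding R_def by (rule drop_var_complete_homogeneous_part[OF ka])
    have "(\<Sum>l<n. a ! skip k l * (j + of_bool (k < skip k l))) = j * A + B"
      unfolding B[symmetric] A_def by (simp add: distrib_left sum.distrib sum_distrib_left mult.commute)
    moreover have "dyson n ((!) a \<circ> skip k) = dyson (length (omit k a)) ((!) (omit k a))"
      using ka assms(1) by (auto simp: length_omit nth_omit intro!: dyson_cong)
    ultimately have dres: "drop_var k (residue n ((!) a) k j) = scalar (partial_fraction_weight (a ! k) j *
        qq ^ (j * A + B)) * dyson (length (omit k a)) ((!) (omit k a))"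
      by (simp add: drop_var_residue)
    have "ord_ge k 0 (X k)" "ord_ge k 0 R"
      unfolding X_def R_def by (auto intro!: ord_ge_prod ord_ge_xpow ord_ge_complete_homogeneous_part)
    then have "drop_var k (T k j) = drop_var k (X k) * drop_var k R * drop_var k (residue n ((!) a) k j)"
      unfolding T_def by (simp add: drop_var_mult ord_ge_mult_0 ord_ge_residue)
    then have "constant_term (T k j) = constant_term (scalar (partial_fraction_weight (a ! k) j * qq ^ (j * A + B)) *
        (drop_var k (X k) * drop_var k R * dyson (length (omit k a)) ((!) (omit k a))))"
      unfolding constant_term_drop_var[of k "T k j", symmetric] dres by (simp only: ac_simps)
    then show ?thesis by (simp only: constant_term_scalar_mult D'_def D_eq dX dR)
  qed

  have "D (map int v) (decreasing v) a = constant_term ((\<Prod>i<Suc n. xpow i (- int (v ! i))) * R *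
      (dyson (Suc n) ((!) a) * complete_homogeneous M (alphabet a)))"
    unfolding D_eq part using assms(1,2) by (simp add: ac_simps)
  also have "\<dots> = (\<Sum>i<Suc n. \<Sum>j<a ! i. qq ^ (j * M) * constant_term (xpow i (int M - int (v ! i)) * T i j))"
    using assms(1) nontriv
    by (subst dyson_complete_homogeneous)
      (auto simp: sum_distrib_left constant_term_sum summand constant_term_scalar_mult
        simp del: sum.lessThan_Suc prod.lessThan_Suc intro!: sum.cong)
  also have "\<dots> = (\<Sum>i<Suc n. if i = k then \<Sum>j<a ! k. qq ^ (j * M) * constant_term (T k j) else 0)"
  proof (intro sum.cong refl)
    fix i assume "i \<in> {..<Suc n}"
    then show "(\<Sum>j<a ! i. qq ^ (j * M) * constant_term (xpow i (int M - int (v ! i)) * T i j))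
        = (if i = k then \<Sum>j<a ! k. qq ^ (j * M) * constant_term (T k j) else 0)"
      by (cases "i = k") (simp_all add: zero, simp add: M_def)
  qed
  also have "\<dots> = (\<Sum>j<a ! k. qq ^ (j * M) * constant_term (T k j))"
    using assms(4) by (simp del: sum.lessThan_Suc)
  \<comment> \<open>The powers of q depending on \<open>j\<close> come from the letter, j M, and
    from the residue, j A; together they form the degree M + A in the one-variable
    expansion.\<close>
  also have "\<dots> = qq ^ B * (\<Sum>j<a ! k. partial_fraction_weight (a ! k) j * (qq ^ j) ^ (M + A)) * D'"
    by (simp add: CTk sum_distrib_left sum_distrib_right power_add power_mult[symmetric] distrib_left ac_simps)
  also have "(\<Sum>j<a ! k. partial_fraction_weight (a ! k) j * (qq ^ j) ^ (M + A))
      = q_binomial qq (int M + int (sum_list a) - 1) (int (a ! k) - 1)"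
  \<comment> \<open>For a_k = 0 the sum is empty and the q-binomial coefficient has lower index -1,
    so both sides are 0. Otherwise M + A + a_k equals M + |a|.\<close>
  proof (cases "a ! k = 0")
    case False
    have "sum_list a = a ! k + A"
      using sum.lessThan_Suc_skip[OF assms(4), of "(!) a"] assms(1)
      by (simp add: A_def sum_list_sum_nth lessThan_atLeast0)
    then show ?thesis
      using sum_partial_fraction_weight[of "a ! k" "M + A"] False by (simp add: algebra_simps)
  qed (simp add: q_binomial_def)
  finally show ?thesis by (simp only: B_def M_def D'_def lam_def)
qed

end
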